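(* Let $R$ be a ring, $e\in R$ an idempotent, $f:=1-e$, and $a\in Re$. Put $\alpha:=eae\in eRe$ and $\tau:=fae\in fRe$. The following are equivalent: (1) The element $a$ is clean in $R$. (2) There exist an idempotent $\varepsilon\in eRe$, a unit $\mu\in U(eRe)$, $\beta\in eRf$, and $\gamma\in fRe$ such that $$\varepsilon=\varepsilon\mu\alpha+\varepsilon\beta(\tau+\gamma\alpha)\qquad\text{and}\qquad e-\varepsilon=-(e-\varepsilon)\mu(e-\alpha).$$ (3) There exist an idempotent $\varepsilon\in eRe$, a unit $\mu\in U(eRe)$, $\beta\in eRf$, and $\gamma\in fRe$ such that $$\alpha=\varepsilon+\mu+(e-\varepsilon)\beta(\tau+\gamma\alpha).$$
   Context: Rings are associative with $1$, not necessarily commutative. An element $a$ of a ring $R$ is clean in $R$ if $a=g+u$ for some idempotent $g\in R$ and some unit $u\in R$. For an idempotent $e$, $eRe$ is the corner ring with identity $e$, and $U(eRe)$ is its group of units. *)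

theory Defs
  imports "HOL-Algebra.Ring"
begin

definition is_idempotent :: "('a, 'b) ring_scheme \<Rightarrow> 'a \<Rightarrow> bool"
  where "is_idempotent R e \<longleftrightarrow> e \<in> carrier R \<and> e \<otimes>\<^bsub>R\<^esub> e = e"

definition clean :: "('a, 'b) ring_scheme \<Rightarrow> 'a \<Rightarrow> bool"
  where "clean R a \<longleftrightarrow> (\<exists>g u. is_idempotent R g \<and> u \<in> Units R \<and> a = g \<oplus>\<^bsub>R\<^esub> u)"

definition left_mult :: "('a, 'b) ring_scheme \<Rightarrow> 'a \<Rightarrow> 'a set"
  where "left_mult R e = {r \<otimes>\<^bsub>R\<^esub> e | r. r \<in> carrier R}"

definition peirce :: "('a, 'b) ring_scheme \<Rightarrow> 'a \<Rightarrow> 'a \<Rightarrow> 'a set"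
  where "peirce R e f = {e \<otimes>\<^bsub>R\<^esub> r \<otimes>\<^bsub>R\<^esub> f | r. r \<in> carrier R}"

text \<open>The corner ring $eRe$: operations and zero are those of $R$, the identity is $e$. Hence
  \<open>Units (corner R e)\<close> is $U(eRe)$, with inverses taken relative to $e$.\<close>

definition corner :: "('a, 'b) ring_scheme \<Rightarrow> 'a \<Rightarrow> ('a, 'b) ring_scheme"
  where "corner R e = R\<lparr>carrier := peirce R e e, one := e\<rparr>"

lemma (in ring) ring_corner:
  assumes "is_idempotent R e"
  shows "ring (corner R e)"
proof -
  have e: "e \<in> carrier R" and ee: "e \<otimes> e = e"
    using assms by (auto simp: is_idempotent_def)
  have mem: "x \<in> peirce R e e \<longleftrightarrow> x \<in> carrier R \<and> e \<otimes> x = x \<and> x \<otimes> e = x" for x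
  proof
    assume "x \<in> peirce R e e"
    then obtain r where r: "r \<in> carrier R" and x: "x = e \<otimes> r \<otimes> e"
      by (auto simp: peirce_def)
    have "e \<otimes> x = (e \<otimes> e) \<otimes> r \<otimes> e" "x \<otimes> e = e \<otimes> r \<otimes> (e \<otimes> e)"
      using e r by (simp_all only: x m_assoc m_closed)
    then show "x \<in> carrier R \<and> e \<otimes> x = x \<and> x \<otimes> e = x"
      using e r x ee by simp
  next
    assume "x \<in> carrier R \<and> e \<otimes> x = x \<and> x \<otimes> e = x"
    then show "x \<in> peirce R e e"
      unfolding peirce_def by force
  qed
  have sub: "peirce R e e \<subseteq> carrier R"
    by (auto simp: mem)
  have closed: "x \<oplus> y \<in> peirce R e e" "x \<otimes> y \<in> peirce R e e"
    if "x \<in> peirce R e e" "y \<in> peirce R e e" for x y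
  proof -
    have "e \<otimes> (x \<otimes> y) = (e \<otimes> x) \<otimes> y" "x \<otimes> y \<otimes> e = x \<otimes> (y \<otimes> e)"
      using that e m_assoc[of e x y] m_assoc[of x y e] by (auto simp only: mem)
    then show "x \<oplus> y \<in> peirce R e e" "x \<otimes> y \<in> peirce R e e"
      using that e by (simp_all add: mem l_distr r_distr)
  qed
  have neg: "\<exists>y\<in>peirce R e e. y \<oplus> x = \<zero>" if "x \<in> peirce R e e" for x
    using that e by (intro bexI[of _ "\<ominus> x"]) (auto simp: mem l_neg l_minus r_minus)
  have one: "e \<in> peirce R e e" and zero: "\<zero> \<in> peirce R e e"
    using e ee by (simp_all add: mem)
  have unit: "e \<otimes> x = x" "x \<otimes> e = x" if "x \<in> peirce R e e" for x
    using that by (simp_all add: mem)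
  note c = subsetD[OF sub]
  show ?thesis
  proof (rule ringI)
    show "abelian_group (corner R e)"
      by (rule abelian_groupI)
        (use closed neg zero in \<open>simp_all add: corner_def c a_ac\<close>)
    show "monoid (corner R e)"
      by (rule monoidI) (use closed one unit in \<open>simp_all add: corner_def c m_assoc\<close>)
  qed (simp_all add: corner_def c l_distr r_distr)
qed

end

(* The element a is clean iff w a = p w + t for some idempotent p and units w, t: conjugate by w.
   Let a = g + u and v = u^-1. The idempotent h = v (1 - g) u satisfies h v a = h, hence lies in Re.
   So e h is an idempotent of eRe, and conjugating h by the unipotent 1 - f h turns it into e h; this
   gives such a relation with p = 1 - epsilon, where epsilon = e h, and t = 1 - delta with delta in fRe.
   Reading off its Peirce components shows f w f = -f and (e - epsilon) w f = 0, so the Schur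
   complement mu = e w e + e w f w e of the corner f w f = -f is a unit of eRe. With beta = e w f and
   gamma = - f w e the remaining component is
     mu alpha + epsilon beta (tau + gamma alpha) = e + (e - epsilon) mu,
   and each step is reversible. Multiplying this equation by epsilon and e - epsilon gives (2);
   multiplying it by mu^-1 gives (3), for the data mu^-1 (e - epsilon) mu, mu^-1, - mu^-1 beta, gamma. *)
theory Submission
  imports Defs
begin

section \<open>Complementary idempotents, units and corner rings\<close>

text \<open>The sum \<open>s\<close> is a parameter, so that the notion covers both
  \<open>e \<oplus> f = \<one>\<close> and splittings of \<open>e\<close> inside its corner. Naming
  the complement, instead of writing a difference, turns orthogonality into rewrite rules and lets
  the two idempotents exchange roles.\<close>

definition complementary :: "('a, 'b) ring_scheme \<Rightarrow> 'a \<Rightarrow> 'a \<Rightarrow> 'a \<Rightarrow> bool"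
  where "complementary R s p q \<longleftrightarrow> p \<in> carrier R \<and> q \<in> carrier R \<and> p \<otimes>\<^bsub>R\<^esub> p = p \<and> q \<otimes>\<^bsub>R\<^esub> q = q \<and>
    p \<otimes>\<^bsub>R\<^esub> q = \<zero>\<^bsub>R\<^esub> \<and> q \<otimes>\<^bsub>R\<^esub> p = \<zero>\<^bsub>R\<^esub> \<and> p \<oplus>\<^bsub>R\<^esub> q = s"

context ring
begin

text \<open>Meant for use with \<open>THEN\<close> or \<open>OF\<close>: a known product becomes a
  rewrite rule that also fires inside products nested to the right by
  \<open>m_assoc\<close>.\<close>

lemma mult_assoc_rule:
  "\<lbrakk>x \<otimes> y = z; x \<in> carrier R; y \<in> carrier R; t \<in> carrier R\<rbrakk> \<Longrightarrow> x \<otimes> (y \<otimes> t) = z \<otimes> t"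
  using m_assoc by auto

lemma mult_zero_right:
  "\<lbrakk>x \<otimes> y = x; y \<otimes> z = \<zero>; x \<in> carrier R; y \<in> carrier R; z \<in> carrier R\<rbrakk> \<Longrightarrow> x \<otimes> z = \<zero>"
  using m_assoc[of x y z] by simp

lemma mult_zero_left:
  "\<lbrakk>y \<otimes> x = x; z \<otimes> y = \<zero>; x \<in> carrier R; y \<in> carrier R; z \<in> carrier R\<rbrakk> \<Longrightarrow> z \<otimes> x = \<zero>"
  using m_assoc[of z y x] by simp

text \<open>Cancellations that ordered rewriting with \<open>a_ac\<close> and \<open>r_neg2\<close> misses, because it does not
  bring a summand next to its negative.\<close>
lemma add_cancel:
  assumes "x \<in> carrier R" "y \<in> carrier R" "z \<in> carrier R" "t \<in> carrier R"
  shows "x \<oplus> (y \<oplus> (\<ominus> x \<oplus> z)) = y \<oplus> z"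
    and "x \<oplus> (y \<oplus> (z \<oplus> (\<ominus> x \<oplus> t))) = y \<oplus> (z \<oplus> t)"
  using assms a_lcomm[of y "\<ominus> x" z] a_lcomm[of z "\<ominus> x" t] a_lcomm[of y "\<ominus> x" "z \<oplus> t"]
  by (simp_all add: r_neg2)

lemma peirce_iff:
  assumes "is_idempotent R p" "is_idempotent R q"
  shows "x \<in> peirce R p q \<longleftrightarrow> x \<in> carrier R \<and> p \<otimes> x = x \<and> x \<otimes> q = x"
proof
  have pq: "p \<in> carrier R" "q \<in> carrier R" "p \<otimes> p = p" "q \<otimes> q = q"
    using assms by (auto simp: is_idempotent_def)
  show "x \<in> carrier R \<and> p \<otimes> x = x \<and> x \<otimes> q = x" if "x \<in> peirce R p q"
    using that pq
    by (auto simp: peirce_def m_assoc pq(3,4)[THEN mult_assoc_rule])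
  show "x \<in> peirce R p q" if "x \<in> carrier R \<and> p \<otimes> x = x \<and> x \<otimes> q = x"
    using that unfolding peirce_def by force
qed

lemma complementary_minus:
  assumes "s \<in> carrier R" "p \<in> carrier R" "s \<otimes> s = s" "p \<otimes> p = p" "s \<otimes> p = p" "p \<otimes> s = p"
  shows "complementary R s p (s \<ominus> p)"
  unfolding complementary_def using assms
  by (simp add: minus_eq l_distr r_distr l_minus r_minus r_neg l_neg a_assoc a_lcomm[of p s])

text \<open>Cancelling \<open>w\<close> on the left writes \<open>a\<close> as the sum of a
  conjugate of \<open>h\<close> and the unit \<open>inv w \<otimes> t\<close>.\<close>

lemma clean_of_intertwiner:
  assumes "is_idempotent R h" "w \<in> Units R" "t \<in> Units R" "a \<in> carrier R"
    and eq: "w \<otimes> a = h \<otimes> w \<oplus> t"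
  shows "clean R a"
proof -
  have h: "h \<in> carrier R" "h \<otimes> h = h" using assms by (auto simp: is_idempotent_def)
  have w: "w \<in> carrier R" "inv w \<in> carrier R" "w \<otimes> inv w = \<one>" "inv w \<otimes> w = \<one>" "t \<in> carrier R"
    using assms by auto
  have "a = inv w \<otimes> (w \<otimes> a)" using w assms(4) mult_assoc_rule[of "inv w" w \<one> a] by simp
  also have "\<dots> = inv w \<otimes> h \<otimes> w \<oplus> inv w \<otimes> t"
    using w h by (simp add: eq r_distr m_assoc)
  finally have "a = inv w \<otimes> h \<otimes> w \<oplus> inv w \<otimes> t" .
  moreover have "is_idempotent R (inv w \<otimes> h \<otimes> w)"
    using w h by (simp add: is_idempotent_def m_assoc w(3)[THEN mult_assoc_rule] h(2)[THEN mult_assoc_rule])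
  moreover have "inv w \<otimes> t \<in> Units R" using assms by simp
  ultimately show ?thesis unfolding clean_def by blast
qed

lemma Units_minus_nilpotent:
  assumes "n \<in> carrier R" "n \<otimes> n = \<zero>"
  shows "\<one> \<ominus> n \<in> Units R"
proof -
  have "(\<one> \<ominus> n) \<otimes> (\<one> \<oplus> n) = \<one>" "(\<one> \<oplus> n) \<otimes> (\<one> \<ominus> n) = \<one>"
    using assms by (simp_all add: minus_eq l_distr r_distr l_minus r_minus a_assoc r_neg l_neg)
  then show ?thesis using assms unfolding Units_def by blast
qed

lemma Units_corner_iff:
  "x \<in> Units (corner R e) \<longleftrightarrow> x \<in> peirce R e e \<and>
    (\<exists>y \<in> peirce R e e. x \<otimes> y = e \<and> y \<otimes> x = e)"
  by (auto simp: Units_def corner_def)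

lemma is_idempotent_corner_iff:
  "is_idempotent (corner R e) x \<longleftrightarrow> x \<in> peirce R e e \<and> x \<otimes> x = x"
  by (auto simp: is_idempotent_def corner_def)

lemma complementary_absorb:
  assumes "complementary R s p q"
  shows "s \<otimes> p = p" "p \<otimes> s = p" "s \<otimes> q = q" "q \<otimes> s = q" "s \<otimes> s = s" "s \<in> carrier R"
proof -
  have *: "p \<in> carrier R" "q \<in> carrier R" "p \<otimes> p = p" "q \<otimes> q = q"
    "p \<otimes> q = \<zero>" "q \<otimes> p = \<zero>" and s: "s = p \<oplus> q"
    using assms by (auto simp: complementary_def)
  then show "s \<otimes> p = p" "p \<otimes> s = p" "s \<otimes> q = q" "q \<otimes> s = q" "s \<otimes> s = s" "s \<in> carrier R"
    by (simp_all add: s l_distr r_distr)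
qed

end

section \<open>Peirce decomposition with respect to \<open>e \<oplus> f = \<one>\<close>\<close>

locale peirce_decomposition = ring +
  fixes e f
  assumes compl: "complementary R \<one> e f"
begin

lemma ef_closed [simp]: "e \<in> carrier R" "f \<in> carrier R"
  and ef_mult [simp]: "e \<otimes> e = e" "f \<otimes> f = f" "e \<otimes> f = \<zero>" "f \<otimes> e = \<zero>"
  and ef_sum: "e \<oplus> f = \<one>"
  using compl by (auto simp: complementary_def)

lemma ef_mult_left [simp]:
  assumes "x \<in> carrier R"
  shows "e \<otimes> (e \<otimes> x) = e \<otimes> x" "f \<otimes> (f \<otimes> x) = f \<otimes> x" "e \<otimes> (f \<otimes> x) = \<zero>" "f \<otimes> (e \<otimes> x) = \<zero>"
  using assms by (simp_all flip: m_assoc)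

lemma ef_idem: "is_idempotent R e" "is_idempotent R f"
  by (simp_all add: is_idempotent_def)

text \<open>Collects all products with \<open>e\<close> and \<open>f\<close>, zeros included, so
  that block matrix calculations become rewriting.\<close>

lemma peirce_mult:
  "x \<in> peirce R e e \<longleftrightarrow> x \<in> carrier R \<and> e \<otimes> x = x \<and> x \<otimes> e = x \<and> f \<otimes> x = \<zero> \<and> x \<otimes> f = \<zero>"
  "x \<in> peirce R e f \<longleftrightarrow> x \<in> carrier R \<and> e \<otimes> x = x \<and> x \<otimes> e = \<zero> \<and> f \<otimes> x = \<zero> \<and> x \<otimes> f = x"
  "x \<in> peirce R f e \<longleftrightarrow> x \<in> carrier R \<and> e \<otimes> x = \<zero> \<and> x \<otimes> e = x \<and> f \<otimes> x = x \<and> x \<otimes> f = \<zero>"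
  unfolding peirce_iff[OF ef_idem(1) ef_idem(1)] peirce_iff[OF ef_idem(1) ef_idem(2)]
    peirce_iff[OF ef_idem(2) ef_idem(1)]
  by (auto intro: mult_zero_left[of e _ f] mult_zero_left[of f _ e]
      mult_zero_right[of _ e f] mult_zero_right[of _ f e])

lemma mult_f: "\<lbrakk>x \<in> carrier R; x \<otimes> e = x\<rbrakk> \<Longrightarrow> x \<otimes> f = \<zero>"
  by (rule mult_zero_right[of _ e]) simp_all

lemma mult_1: "x \<in> carrier R \<Longrightarrow> e \<otimes> x \<oplus> f \<otimes> x = x"
  using l_distr[of e f x] by (simp add: ef_sum)

section \<open>Cleanness implies the corner equation\<close>

text \<open>The block \<open>- f\<close> is its own inverse in the corner of \<open>f\<close>, so
  the expression is the Schur complement of that block in \<open>w\<close>. As for matrices, its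
  inverse is the block of \<open>inv w\<close> at \<open>e\<close>.\<close>

lemma Units_corner_of_Units:
  assumes w: "w \<in> Units R" and fwf: "f \<otimes> (w \<otimes> f) = \<ominus> f"
  shows "e \<otimes> w \<otimes> e \<oplus> e \<otimes> w \<otimes> f \<otimes> w \<otimes> e \<in> Units (corner R e)"
proof -
  let ?v = "inv w"
  have wv [simp]: "w \<in> carrier R" "?v \<in> carrier R" "w \<otimes> ?v = \<one>" "?v \<otimes> w = \<one>"
    using w by auto
  note [simp] = mult_assoc_rule[OF wv(3)] mult_assoc_rule[OF wv(4)] fwf
  \<comment> \<open>Trades an inner \<open>e\<close> for \<open>\<one>\<close> minus
    \<open>f\<close>. Then \<open>w\<close> meets its inverse, and the leftover terms with an inner
    \<open>f\<close> cancel by \<open>fwf'\<close>.\<close>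
  have split: "x \<otimes> (e \<otimes> y) = x \<otimes> y \<oplus> \<ominus> (x \<otimes> (f \<otimes> y))" if "x \<in> carrier R" "y \<in> carrier R" for x y
  proof -
    have "x \<otimes> y = x \<otimes> (e \<otimes> y) \<oplus> x \<otimes> (f \<otimes> y)"
      using that mult_1[of y] r_distr[of "e \<otimes> y" "f \<otimes> y" x] by simp
    then show ?thesis using that by (simp add: a_assoc r_neg)
  qed
  have fwf' [simp]: "f \<otimes> (w \<otimes> (f \<otimes> y)) = \<ominus> (f \<otimes> y)" if "y \<in> carrier R" for y
  proof -
    have "f \<otimes> (w \<otimes> (f \<otimes> y)) = (f \<otimes> (w \<otimes> f)) \<otimes> y" using that by (simp only: m_assoc wv ef_closed m_closed)
    then show ?thesis using that by (simp add: l_minus)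
  qed
  have 1: "(e \<otimes> w \<otimes> e \<oplus> e \<otimes> w \<otimes> f \<otimes> w \<otimes> e) \<otimes> (e \<otimes> ?v \<otimes> e) = e"
    by (simp add: l_distr r_distr m_assoc split[of w] l_minus r_minus minus_add a_assoc r_neg l_neg)
  have 2: "(e \<otimes> ?v \<otimes> e) \<otimes> (e \<otimes> w \<otimes> e \<oplus> e \<otimes> w \<otimes> f \<otimes> w \<otimes> e) = e"
    by (simp add: l_distr r_distr m_assoc split[of ?v] l_minus r_minus minus_add a_assoc r_neg l_neg)
  show ?thesis unfolding Units_corner_iff
    by (intro conjI bexI[OF _ _, where x = "e \<otimes> ?v \<otimes> e"] 1 2)
      (simp_all add: peirce_iff ef_idem l_distr r_distr m_assoc)
qed

text \<open>The relation \<open>va\<close> is already of the required shape, with the unit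
  \<open>\<one>\<close> as last summand. Left multiplication by
  \<open>\<one> \<ominus> \<gamma>\<close> replaces \<open>\<one> \<ominus> h\<close> by an
  idempotent that is diagonal for \<open>e\<close> and \<open>f\<close>, at the price of changing
  that summand to \<open>\<one> \<ominus> \<gamma>\<close>.\<close>

lemma clean_imp_intertwiner:
  assumes a: "a \<in> carrier R" "a \<otimes> e = a" and "clean R a"
  obtains \<epsilon> \<eta> w \<gamma> where "complementary R e \<epsilon> \<eta>" "w \<in> Units R" "\<gamma> \<in> peirce R f e"
    "w \<otimes> a = (\<eta> \<oplus> f) \<otimes> w \<oplus> (\<one> \<ominus> \<gamma>)"
proof -
  obtain g u where g: "is_idempotent R g" and u: "u \<in> Units R" and agu: "a = g \<oplus> u"
    using assms by (auto simp: clean_def)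
  define v where "v = inv u"
  define h where "h = v \<otimes> (\<one> \<ominus> g) \<otimes> u"
  have [simp]: "u \<in> carrier R" "v \<in> carrier R" and uv [simp]: "u \<otimes> v = \<one>" "v \<otimes> u = \<one>" and v: "v \<in> Units R"
    using u by (auto simp: v_def)
  have gg [simp]: "g \<in> carrier R" "g \<otimes> g = g"
    using g by (auto simp: is_idempotent_def)
  note [simp] = mult_assoc_rule[OF uv(1)] mult_assoc_rule[OF uv(2)] mult_assoc_rule[OF gg(2)]
  have h [simp]: "h \<in> carrier R" unfolding h_def by simp
  have hh [simp]: "h \<otimes> h = h"
    by (simp add: h_def minus_eq l_distr r_distr l_minus r_minus m_assoc minus_add r_neg l_neg r_neg1 r_neg2 a_assoc)
  \<comment> \<open>With \<open>a = g \<oplus> u\<close>, the factor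
    \<open>\<one> \<ominus> g\<close> kills \<open>g\<close>, and only the summand \<open>u\<close>
    survives. Since \<open>a\<close> absorbs \<open>e\<close> on the right, so does
    \<open>h\<close>.\<close>
  have hva: "h \<otimes> v \<otimes> a = h"
    by (simp add: h_def agu minus_eq l_distr r_distr l_minus r_minus m_assoc minus_add r_neg l_neg r_neg1 r_neg2 a_assoc)
  have he [simp]: "h \<otimes> e = h"
    using m_assoc[of "h \<otimes> v" a e] by (simp add: hva a)
  have hf [simp]: "h \<otimes> f = \<zero>" by (rule mult_f) simp_all
  note [simp] = mult_assoc_rule[OF hh] mult_assoc_rule[OF he] mult_assoc_rule[OF hf]
  define \<epsilon> where "\<epsilon> = e \<otimes> h"
  define \<eta> where "\<eta> = e \<ominus> \<epsilon>"
  define \<gamma> where "\<gamma> = f \<otimes> h"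
  define w where "w = (\<one> \<ominus> \<gamma>) \<otimes> v"
  have va: "v \<otimes> a = (\<one> \<ominus> h) \<otimes> v \<oplus> \<one>"
    by (simp add: h_def agu minus_eq l_distr r_distr l_minus r_minus m_assoc minus_add r_neg l_neg r_neg1 r_neg2 a_assoc)
  have compl: "complementary R e \<epsilon> \<eta>" unfolding \<eta>_def
    by (rule complementary_minus) (simp_all add: \<epsilon>_def m_assoc)
  have \<gamma>: "\<gamma> \<in> peirce R f e"
    by (simp add: \<gamma>_def peirce_iff ef_idem m_assoc)
  have w: "w \<in> Units R"
    unfolding w_def by (intro Units_m_closed v Units_minus_nilpotent) (simp_all add: \<gamma>_def m_assoc)
  have \<gamma>h: "\<gamma> \<in> carrier R" "\<epsilon> \<in> carrier R" "\<gamma> \<otimes> h = \<gamma>" "\<epsilon> \<otimes> \<gamma> = \<zero>" "h = \<epsilon> \<oplus> \<gamma>"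
    by (simp_all add: \<gamma>_def \<epsilon>_def m_assoc mult_1)
  \<comment> \<open>This is the complement of \<open>\<epsilon>\<close> in the whole ring. The
    exchange rule \<open>swap\<close> holds because both of its sides equal
    \<open>\<one> \<ominus> h\<close>: on one side
    \<open>\<epsilon> \<otimes> \<gamma> = \<zero>\<close>, on the other
    \<open>\<gamma> \<otimes> h = \<gamma>\<close>.\<close>
  have "\<eta> \<oplus> f = \<one> \<ominus> \<epsilon>"
    using \<gamma>h by (simp add: \<eta>_def minus_eq a_ac flip: ef_sum)
  then have "(\<eta> \<oplus> f) \<otimes> (\<one> \<ominus> \<gamma>) = (\<one> \<ominus> \<epsilon>) \<otimes> (\<one> \<ominus> \<gamma>)"
    by (rule arg_cong)
  also have "\<dots> = \<one> \<ominus> (\<epsilon> \<oplus> \<gamma>)"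
    using \<gamma>h(1,2,4) by (simp add: minus_eq l_distr r_distr l_minus r_minus minus_add a_assoc)
  also have "\<dots> = (\<one> \<ominus> \<gamma>) \<otimes> (\<one> \<ominus> h)"
    unfolding \<gamma>h(5)[symmetric] using \<gamma>h(1,3)
    by (simp add: minus_eq l_distr r_distr l_minus r_minus minus_add a_ac l_neg r_neg r_neg1 r_neg2)
  finally have swap: "(\<one> \<ominus> \<gamma>) \<otimes> (\<one> \<ominus> h) = (\<eta> \<oplus> f) \<otimes> (\<one> \<ominus> \<gamma>)" ..
  have "w \<otimes> a = (\<one> \<ominus> \<gamma>) \<otimes> (v \<otimes> a)"
    unfolding w_def using a \<gamma>h(1-4) by (simp add: m_assoc)
  also have "\<dots> = ((\<one> \<ominus> \<gamma>) \<otimes> (\<one> \<ominus> h)) \<otimes> v \<oplus> (\<one> \<ominus> \<gamma>)"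
    unfolding va using \<gamma>h(1-4) by (simp add: r_distr m_assoc)
  also have "\<dots> = (\<eta> \<oplus> f) \<otimes> w \<oplus> (\<one> \<ominus> \<gamma>)"
    unfolding swap w_def using \<gamma>h(1,2) by (simp add: m_assoc \<eta>_def)
  finally have "w \<otimes> a = (\<eta> \<oplus> f) \<otimes> w \<oplus> (\<one> \<ominus> \<gamma>)" .
  then show thesis using that compl w \<gamma> by blast
qed

text \<open>Three of the four Peirce components of the intertwining relation are used; the one in
  \<open>peirce R f e\<close> merely expresses \<open>\<delta>\<close> through \<open>w\<close> and
  \<open>a\<close>.\<close>

lemma corner_equation_of_intertwiner:
  assumes a: "a \<in> carrier R" "a \<otimes> e = a" and compl': "complementary R e \<epsilon> \<eta>"
    and w: "w \<in> Units R" and \<delta>: "\<delta> \<in> peirce R f e"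
    and eq: "w \<otimes> a = (\<eta> \<oplus> f) \<otimes> w \<oplus> (\<one> \<ominus> \<delta>)"
  obtains \<mu> \<beta> \<gamma> where "\<mu> \<in> Units (corner R e)" "\<beta> \<in> peirce R e f" "\<gamma> \<in> peirce R f e"
    "\<mu> \<otimes> (e \<otimes> a) \<oplus> \<epsilon> \<otimes> \<beta> \<otimes> (f \<otimes> a \<oplus> \<gamma> \<otimes> (e \<otimes> a)) = e \<oplus> \<eta> \<otimes> \<mu>"
proof -
  have wc [simp]: "w \<in> carrier R" using w by auto
  have \<epsilon>: "\<epsilon> \<in> carrier R" "\<eta> \<in> carrier R" "\<epsilon> \<otimes> \<epsilon> = \<epsilon>" "\<eta> \<otimes> \<eta> = \<eta>" "\<epsilon> \<otimes> \<eta> = \<zero>" "\<eta> \<otimes> \<epsilon> = \<zero>"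
    and sum: "\<epsilon> \<oplus> \<eta> = e"
    using compl' by (auto simp: complementary_def)
  note absorb = complementary_absorb(1-4)[OF compl']
  have zero: "f \<otimes> \<eta> = \<zero>" "\<eta> \<otimes> f = \<zero>"
    using mult_zero_left[of e \<eta> f] mult_f[of \<eta>] by (simp_all add: absorb \<epsilon>)
  note \<delta>' = \<delta>[unfolded peirce_mult]
  note [simp] = \<epsilon> absorb zero \<delta>'
  note [simp] = \<epsilon>(3-6)[THEN mult_assoc_rule] absorb[THEN mult_assoc_rule] zero[THEN mult_assoc_rule]
  have af [simp]: "a \<otimes> f = \<zero>" by (rule mult_f) (simp_all add: a)
  note [simp] = a a(2)[THEN mult_assoc_rule]
  \<comment> \<open>Since \<open>a \<otimes> f = \<zero>\<close>, the left sides of \<open>F\<close>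
    and \<open>E\<close> vanish. These two components constrain \<open>w\<close> alone, and
    \<open>A\<close> carries the information on \<open>a\<close>.\<close>
  have F: "f \<otimes> ((w \<otimes> a) \<otimes> f) = f \<otimes> (((\<eta> \<oplus> f) \<otimes> w \<oplus> (\<one> \<ominus> \<delta>)) \<otimes> f)"
    and E: "e \<otimes> ((w \<otimes> a) \<otimes> f) = e \<otimes> (((\<eta> \<oplus> f) \<otimes> w \<oplus> (\<one> \<ominus> \<delta>)) \<otimes> f)"
    and A: "e \<otimes> ((w \<otimes> a) \<otimes> e) = e \<otimes> (((\<eta> \<oplus> f) \<otimes> w \<oplus> (\<one> \<ominus> \<delta>)) \<otimes> e)"
    using eq by simp_all
  have "f \<otimes> (w \<otimes> f) \<oplus> f = \<zero>"
    using F[symmetric] by (simp add: minus_eq l_distr r_distr l_minus r_minus m_assoc)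
  then have fwf: "f \<otimes> (w \<otimes> f) = \<ominus> f"
    by (simp add: minus_equality)
  have \<eta>wf [simp]: "\<eta> \<otimes> (w \<otimes> f) = \<zero>"
    using E[symmetric] by (simp add: minus_eq l_distr r_distr l_minus r_minus m_assoc)
  have ewa: "e \<otimes> (w \<otimes> a) = e \<oplus> \<eta> \<otimes> (w \<otimes> e)"
    using A by (simp add: minus_eq l_distr r_distr l_minus r_minus m_assoc a_comm)
  have \<eta>wf' [simp]: "\<eta> \<otimes> (w \<otimes> (f \<otimes> y)) = \<zero>" if "y \<in> carrier R" for y
    using mult_assoc_rule[OF \<eta>wf _ _ that] that by (simp add: m_assoc)
  \<comment> \<open>As \<open>\<eta> \<otimes> (w \<otimes> f)\<close> vanishes, multiplying the
    block \<open>e \<otimes> w \<otimes> f\<close> by \<open>\<epsilon>\<close> does not change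
    it.\<close>
  have ewf: "\<epsilon> \<otimes> (w \<otimes> (f \<otimes> y)) = e \<otimes> (w \<otimes> (f \<otimes> y))" if "y \<in> carrier R" for y
    using that by (simp add: l_distr flip: sum)
  define \<mu> where "\<mu> = e \<otimes> w \<otimes> e \<oplus> e \<otimes> w \<otimes> f \<otimes> w \<otimes> e"
  \<comment> \<open>The correction term in the Schur complement \<open>\<mu>\<close> cancels against
    the product of the two off-diagonal blocks, leaving \<open>e \<otimes> (w \<otimes> a)\<close>.
    In \<open>\<eta> \<otimes> \<mu>\<close> the correction term is killed by
    \<open>\<eta>wf'\<close>.\<close>
  have "\<mu> \<otimes> (e \<otimes> a) \<oplus> \<epsilon> \<otimes> (e \<otimes> w \<otimes> f) \<otimes> (f \<otimes> a \<oplus> (\<ominus> (f \<otimes> w \<otimes> e)) \<otimes> (e \<otimes> a))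
      = e \<otimes> w \<otimes> (e \<otimes> a \<oplus> f \<otimes> a)"
    by (simp add: \<mu>_def l_distr r_distr l_minus r_minus m_assoc ewf a_ac r_neg l_neg r_neg1 r_neg2)
  also have "\<dots> = e \<oplus> \<eta> \<otimes> \<mu>"
    by (simp add: mult_1 \<mu>_def r_distr m_assoc ewa)
  finally have res: "\<mu> \<otimes> (e \<otimes> a) \<oplus> \<epsilon> \<otimes> (e \<otimes> w \<otimes> f) \<otimes> (f \<otimes> a \<oplus> (\<ominus> (f \<otimes> w \<otimes> e)) \<otimes> (e \<otimes> a))
      = e \<oplus> \<eta> \<otimes> \<mu>" .
  have "e \<otimes> w \<otimes> f \<in> peirce R e f" "\<ominus> (f \<otimes> w \<otimes> e) \<in> peirce R f e"
    by (simp_all add: peirce_iff ef_idem m_assoc l_minus r_minus)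
  then show thesis
    using that res Units_corner_of_Units[OF w fwf] unfolding \<mu>_def by blast
qed

section \<open>The corner equation implies cleanness\<close>

text \<open>Rebuilds \<open>w\<close> from its Schur complement \<open>\<mu>\<close> and its
  remaining blocks: \<open>\<epsilon> \<otimes> \<beta>\<close> from \<open>f\<close> to
  \<open>e\<close>, \<open>\<ominus> \<gamma>\<close> from \<open>e\<close> to \<open>f\<close>, and
  \<open>\<ominus> f\<close>. Because \<open>\<beta>\<close> enters only through
  \<open>\<epsilon> \<otimes> \<beta>\<close>, the condition
  \<open>\<eta> \<otimes> (w \<otimes> f) = \<zero>\<close> holds again.\<close>

lemma clean_of_corner_equation:
  assumes a: "a \<in> carrier R" "a \<otimes> e = a" and compl': "complementary R e \<epsilon> \<eta>"
    and \<mu>: "\<mu> \<in> Units (corner R e)" and \<beta>: "\<beta> \<in> peirce R e f" and \<gamma>: "\<gamma> \<in> peirce R f e"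
    and eq: "\<mu> \<otimes> (e \<otimes> a) \<oplus> \<epsilon> \<otimes> \<beta> \<otimes> (f \<otimes> a \<oplus> \<gamma> \<otimes> (e \<otimes> a)) = e \<oplus> \<eta> \<otimes> \<mu>"
  shows "clean R a"
proof -
  obtain m where m: "m \<in> peirce R e e" "\<mu> \<in> peirce R e e" and \<mu>m: "\<mu> \<otimes> m = e" "m \<otimes> \<mu> = e"
    using \<mu> by (auto simp: Units_corner_iff)
  have \<epsilon>: "\<epsilon> \<in> carrier R" "\<eta> \<in> carrier R" "\<epsilon> \<otimes> \<epsilon> = \<epsilon>" "\<eta> \<otimes> \<eta> = \<eta>" "\<epsilon> \<otimes> \<eta> = \<zero>" "\<eta> \<otimes> \<epsilon> = \<zero>"
    and sum: "\<epsilon> \<oplus> \<eta> = e"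
    using compl' by (auto simp: complementary_def)
  note absorb = complementary_absorb(1-4)[OF compl']
  have zero: "f \<otimes> \<eta> = \<zero>" "f \<otimes> \<epsilon> = \<zero>" "\<eta> \<otimes> f = \<zero>" "\<epsilon> \<otimes> f = \<zero>"
    using mult_zero_left[of e \<eta> f] mult_zero_left[of e \<epsilon> f] mult_f[of \<eta>] mult_f[of \<epsilon>]
    by (simp_all add: absorb \<epsilon>)
  note c = m[unfolded peirce_mult] \<beta>[unfolded peirce_mult] \<gamma>[unfolded peirce_mult]
  have closed [simp]: "m \<in> carrier R" "\<mu> \<in> carrier R" "\<beta> \<in> carrier R" "\<gamma> \<in> carrier R"
    using c by auto
  have prods: "e \<otimes> \<mu> = \<mu>" "f \<otimes> \<mu> = \<zero>" "\<mu> \<otimes> e = \<mu>" "\<mu> \<otimes> f = \<zero>"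
    "e \<otimes> m = m" "f \<otimes> m = \<zero>" "m \<otimes> e = m" "m \<otimes> f = \<zero>"
    "e \<otimes> \<beta> = \<beta>" "f \<otimes> \<beta> = \<zero>" "\<beta> \<otimes> e = \<zero>" "\<beta> \<otimes> f = \<beta>"
    "e \<otimes> \<gamma> = \<zero>" "f \<otimes> \<gamma> = \<gamma>" "\<gamma> \<otimes> e = \<gamma>" "\<gamma> \<otimes> f = \<zero>"
    using c by auto
  have cross: "\<beta> \<otimes> \<epsilon> = \<zero>" "\<beta> \<otimes> \<eta> = \<zero>" "\<beta> \<otimes> \<mu> = \<zero>" "\<mu> \<otimes> \<gamma> = \<zero>" "\<gamma> \<otimes> \<gamma> = \<zero>"
    "m \<otimes> \<gamma> = \<zero>" "\<epsilon> \<otimes> \<gamma> = \<zero>" "\<eta> \<otimes> \<gamma> = \<zero>"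
    using mult_zero_right[of \<beta> f \<epsilon>] mult_zero_right[of \<beta> f \<eta>] mult_zero_right[of \<beta> f \<mu>]
      mult_zero_right[of \<mu> e \<gamma>] mult_zero_right[of \<gamma> e \<gamma>] mult_zero_right[of m e \<gamma>]
      mult_zero_right[of \<epsilon> e \<gamma>] mult_zero_right[of \<eta> e \<gamma>]
    by (simp_all add: prods absorb zero \<epsilon>)
  note [simp] = \<epsilon> absorb zero \<mu>m prods cross
  note [simp] = \<epsilon>(3-6)[THEN mult_assoc_rule] absorb[THEN mult_assoc_rule] zero[THEN mult_assoc_rule]
    \<mu>m[THEN mult_assoc_rule] prods[THEN mult_assoc_rule] cross[THEN mult_assoc_rule]
  note expand = minus_eq l_distr r_distr l_minus r_minus m_assoc minus_add
  txt \<open>The unit of the intertwining relation is $(1 - \varepsilon\beta)(\mu - \gamma - f)$, which factors the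
    matrix with the prescribed Schur complement $\mu$.\<close>
  let ?z = "\<mu> \<ominus> \<gamma> \<ominus> f" and ?z' = "m \<ominus> \<gamma> \<otimes> m \<ominus> f" and ?n = "\<epsilon> \<otimes> \<beta>"
  \<comment> \<open>Both matrices are lower triangular; \<open>?z'\<close> has the inverse diagonal
    entries \<open>m\<close> and \<open>\<ominus> f\<close>.\<close>
  have "?z \<otimes> ?z' = \<one>" "?z' \<otimes> ?z = \<one>"
    by (simp_all add: expand ef_sum a_assoc r_neg l_neg r_neg1 r_neg2)
  then have "?z \<in> Units R"
    unfolding Units_def by (auto intro!: bexI[of _ ?z'])
  moreover have n: "\<one> \<ominus> ?n \<in> Units R"
    by (rule Units_minus_nilpotent) (simp_all add: m_assoc)
  ultimately have w: "(\<one> \<ominus> ?n) \<otimes> ?z \<in> Units R"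
    by blast
  have "a \<otimes> \<gamma> = \<zero>" "a \<otimes> f = \<zero>"
    using mult_zero_right[of a e \<gamma>] mult_f[of a] a by simp_all
  note [simp] = a this a(2)[THEN mult_assoc_rule] this[THEN mult_assoc_rule]
  \<comment> \<open>Found by solving the component of the intertwining relation in
    \<open>peirce R f e\<close>. It lies in that component, hence squares to zero.\<close>
  let ?\<delta> = "\<gamma> \<otimes> (e \<otimes> a) \<ominus> \<gamma> \<oplus> f \<otimes> a"
  have \<delta>: "\<one> \<ominus> ?\<delta> \<in> Units R"
    by (rule Units_minus_nilpotent) (simp_all add: expand)
  have "((\<one> \<ominus> ?n) \<otimes> ?z) \<otimes> a =
      (\<mu> \<otimes> (e \<otimes> a) \<oplus> ?n \<otimes> (f \<otimes> a \<oplus> \<gamma> \<otimes> (e \<otimes> a))) \<ominus> \<gamma> \<otimes> a \<ominus> f \<otimes> a"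
    by (simp add: expand a_ac)
  also have "\<dots> = e \<oplus> \<eta> \<otimes> \<mu> \<ominus> \<gamma> \<otimes> a \<ominus> f \<otimes> a"
    unfolding eq ..
  also have "\<dots> = (\<eta> \<oplus> f) \<otimes> ((\<one> \<ominus> ?n) \<otimes> ?z) \<oplus> (\<one> \<ominus> ?\<delta>)"
    by (simp add: expand a_ac r_neg l_neg r_neg1 r_neg2 add_cancel flip: ef_sum)
  finally have "((\<one> \<ominus> ?n) \<otimes> ?z) \<otimes> a = (\<eta> \<oplus> f) \<otimes> ((\<one> \<ominus> ?n) \<otimes> ?z) \<oplus> (\<one> \<ominus> ?\<delta>)" .
  moreover have "is_idempotent R (\<eta> \<oplus> f)"
    by (simp add: is_idempotent_def l_distr r_distr)
  ultimately show ?thesis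
    using clean_of_intertwiner w \<delta> a(1) by blast
qed

section \<open>The corner equation in the forms (2) and (3)\<close>

text \<open>Both sides of the single equation absorb \<open>e = \<epsilon> \<oplus> \<eta>\<close>
  on the left, so it is equivalent to its left multiples by \<open>\<epsilon>\<close> and
  \<open>\<eta>\<close>. These are the two equations of (2), with \<open>\<rho>\<close> standing for
  the product of \<open>\<beta>\<close> and the bracket.\<close>

lemma corner_equations_iff:
  assumes compl': "complementary R e \<epsilon> \<eta>" and \<mu>: "\<mu> \<in> peirce R e e" and \<alpha>: "\<alpha> \<in> peirce R e e"
    and \<rho> [simp]: "\<rho> \<in> carrier R"
  shows "\<epsilon> = \<epsilon> \<otimes> \<mu> \<otimes> \<alpha> \<oplus> \<epsilon> \<otimes> \<rho> \<and> \<eta> = \<ominus> (\<eta> \<otimes> \<mu> \<otimes> (e \<ominus> \<alpha>)) \<longleftrightarrow>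
    \<mu> \<otimes> \<alpha> \<oplus> \<epsilon> \<otimes> \<rho> = e \<oplus> \<eta> \<otimes> \<mu>" (is "?L \<longleftrightarrow> ?R")
proof -
  have \<epsilon>: "\<epsilon> \<in> carrier R" "\<eta> \<in> carrier R" "\<epsilon> \<otimes> \<epsilon> = \<epsilon>" "\<eta> \<otimes> \<eta> = \<eta>" "\<epsilon> \<otimes> \<eta> = \<zero>" "\<eta> \<otimes> \<epsilon> = \<zero>"
    and sum: "\<epsilon> \<oplus> \<eta> = e"
    using compl' by (auto simp: complementary_def)
  note absorb = complementary_absorb(1-4)[OF compl']
  note [simp] = \<epsilon> \<epsilon>(3-6)[THEN mult_assoc_rule] absorb absorb[THEN mult_assoc_rule]
  have c [simp]: "\<mu> \<in> carrier R" "\<alpha> \<in> carrier R" "\<mu> \<otimes> e = \<mu>" and \<mu>\<alpha>: "e \<otimes> \<mu> = \<mu>"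
    using \<mu> \<alpha> by (simp_all add: peirce_mult)
  have expand: "\<ominus> (\<eta> \<otimes> \<mu> \<otimes> (e \<ominus> \<alpha>)) = \<eta> \<otimes> (\<mu> \<otimes> \<alpha>) \<ominus> \<eta> \<otimes> \<mu>"
    by (simp add: minus_eq r_distr r_minus minus_add m_assoc a_comm)
  have decomp: "\<epsilon> \<otimes> (\<mu> \<otimes> \<alpha>) \<oplus> \<eta> \<otimes> (\<mu> \<otimes> \<alpha>) = \<mu> \<otimes> \<alpha>"
    using l_distr[of \<epsilon> \<eta> "\<mu> \<otimes> \<alpha>"] mult_assoc_rule[OF \<mu>\<alpha>, of \<alpha>] by (simp add: sum)
  show ?thesis
  proof
    assume ?L
    then have 1: "\<epsilon> \<otimes> (\<mu> \<otimes> \<alpha>) \<oplus> \<epsilon> \<otimes> \<rho> = \<epsilon>" and 2: "\<eta> \<otimes> (\<mu> \<otimes> \<alpha>) \<ominus> \<eta> \<otimes> \<mu> = \<eta>"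
      using expand by (simp_all add: m_assoc)
    have 3: "\<eta> \<otimes> (\<mu> \<otimes> \<alpha>) = \<eta> \<oplus> \<eta> \<otimes> \<mu>"
      by (subst 2[symmetric]) (simp add: minus_eq a_assoc l_neg)
    have "\<mu> \<otimes> \<alpha> \<oplus> \<epsilon> \<otimes> \<rho> = (\<epsilon> \<otimes> (\<mu> \<otimes> \<alpha>) \<oplus> \<epsilon> \<otimes> \<rho>) \<oplus> \<eta> \<otimes> (\<mu> \<otimes> \<alpha>)"
      by (subst decomp[symmetric]) (simp add: a_ac)
    also have "\<dots> = (\<epsilon> \<oplus> \<eta>) \<oplus> \<eta> \<otimes> \<mu>"
      unfolding 1 3 by (simp add: a_assoc)
    finally show ?R by (simp add: sum)
  next
    assume R: ?R
    have "\<epsilon> \<otimes> (\<mu> \<otimes> \<alpha> \<oplus> \<epsilon> \<otimes> \<rho>) = \<epsilon>" "\<eta> \<otimes> (\<mu> \<otimes> \<alpha> \<oplus> \<epsilon> \<otimes> \<rho>) = \<eta> \<oplus> \<eta> \<otimes> \<mu>"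
      unfolding R by (simp_all add: r_distr)
    then have 1: "\<epsilon> \<otimes> (\<mu> \<otimes> \<alpha>) \<oplus> \<epsilon> \<otimes> \<rho> = \<epsilon>" and 2: "\<eta> \<otimes> (\<mu> \<otimes> \<alpha>) = \<eta> \<oplus> \<eta> \<otimes> \<mu>"
      by (simp_all add: r_distr)
    show ?L
      unfolding expand 2 using 1 by (simp add: m_assoc minus_eq a_assoc r_neg)
  qed
qed

lemma complementary_conj:
  assumes compl': "complementary R e \<epsilon> \<eta>" and xy: "x \<in> peirce R e e" "y \<in> peirce R e e" "x \<otimes> y = e" "y \<otimes> x = e"
  shows "complementary R e (x \<otimes> \<epsilon> \<otimes> y) (x \<otimes> \<eta> \<otimes> y)"
proof -
  have \<epsilon>: "\<epsilon> \<in> carrier R" "\<eta> \<in> carrier R" "\<epsilon> \<otimes> \<epsilon> = \<epsilon>" "\<eta> \<otimes> \<eta> = \<eta>" "\<epsilon> \<otimes> \<eta> = \<zero>" "\<eta> \<otimes> \<epsilon> = \<zero>"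
    and sum: "\<epsilon> \<oplus> \<eta> = e"
    using compl' by (auto simp: complementary_def)
  note absorb = complementary_absorb(1-4)[OF compl']
  have c [simp]: "x \<in> carrier R" "y \<in> carrier R" and ey: "e \<otimes> y = y"
    using xy by (simp_all add: peirce_mult)
  note [simp] = \<epsilon> \<epsilon>(3-6)[THEN mult_assoc_rule] absorb absorb[THEN mult_assoc_rule]
     xy(3,4) xy(3,4)[THEN mult_assoc_rule]
  have "x \<otimes> \<epsilon> \<otimes> y \<oplus> x \<otimes> \<eta> \<otimes> y = x \<otimes> (\<epsilon> \<oplus> \<eta>) \<otimes> y"
    by (simp add: l_distr r_distr)
  also have "\<dots> = e" by (simp add: sum m_assoc ey)
  finally show ?thesis
    by (simp add: complementary_def m_assoc)
qed

text \<open>Multiply the right-hand equation by the corner unit \<open>\<mu>\<close>. The primed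
  data are given by intertwining relations instead of formulas, so that the lemma can also be
  applied with primed and unprimed data exchanged and with \<open>\<mu>\<close> and \<open>m\<close>
  swapped.\<close>

lemma corner_equation_conj_iff:
  assumes compl': "complementary R e \<epsilon> \<eta>" "complementary R e \<epsilon>' \<eta>'"
    and \<mu>: "\<mu> \<in> peirce R e e" "m \<in> peirce R e e" "\<mu> \<otimes> m = e" "m \<otimes> \<mu> = e" and \<alpha>: "\<alpha> \<in> peirce R e e"
    and conj: "\<mu> \<otimes> \<epsilon>' = \<eta> \<otimes> \<mu>" "\<mu> \<otimes> \<eta>' = \<epsilon> \<otimes> \<mu>" and \<beta>: "\<mu> \<otimes> \<beta>' = \<ominus> \<beta>"
    and c [simp]: "\<beta> \<in> carrier R" "\<beta>' \<in> carrier R" "t \<in> carrier R"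
  shows "\<mu> \<otimes> \<alpha> \<oplus> \<epsilon> \<otimes> \<beta> \<otimes> t = e \<oplus> \<eta> \<otimes> \<mu> \<longleftrightarrow> \<alpha> = \<epsilon>' \<oplus> m \<oplus> \<eta>' \<otimes> \<beta>' \<otimes> t"
proof -
  have \<epsilon> [simp]: "\<epsilon> \<in> carrier R" "\<eta> \<in> carrier R" "\<epsilon>' \<in> carrier R" "\<eta>' \<in> carrier R"
    using compl' by (auto simp: complementary_def)
  note [simp] = complementary_absorb(1,3)[OF compl'(2)]
  note [simp] = complementary_absorb(1,3)[OF compl'(2), THEN mult_assoc_rule]
  have [simp]: "\<mu> \<in> carrier R" "m \<in> carrier R" "\<alpha> \<in> carrier R" "e \<otimes> \<alpha> = \<alpha>" "e \<otimes> m = m"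
    using \<mu> \<alpha> by (simp_all add: peirce_mult)
  let ?s = "\<epsilon>' \<oplus> m \<oplus> \<eta>' \<otimes> \<beta>' \<otimes> t"
  have "\<mu> \<otimes> (\<eta>' \<otimes> (\<beta>' \<otimes> t)) = \<ominus> (\<epsilon> \<otimes> (\<beta> \<otimes> t))"
    using mult_assoc_rule[OF conj(2), of "\<beta>' \<otimes> t"] mult_assoc_rule[OF \<beta>, of t]
    by (simp add: m_assoc l_minus r_minus)
  then have s: "\<mu> \<otimes> ?s = \<eta> \<otimes> \<mu> \<oplus> e \<ominus> \<epsilon> \<otimes> \<beta> \<otimes> t"
    by (simp add: r_distr m_assoc conj \<mu> minus_eq)
  \<comment> \<open>Both \<open>\<alpha>\<close> and \<open>?s\<close> absorb \<open>e\<close> on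
    the left, so multiplication by \<open>m\<close> undoes multiplication by
    \<open>\<mu>\<close>.\<close>
  have inj: "\<alpha> = ?s \<longleftrightarrow> \<mu> \<otimes> \<alpha> = \<mu> \<otimes> ?s"
  proof
    assume "\<mu> \<otimes> \<alpha> = \<mu> \<otimes> ?s"
    then have "m \<otimes> (\<mu> \<otimes> \<alpha>) = m \<otimes> (\<mu> \<otimes> ?s)" by simp
    then show "\<alpha> = ?s"
      using mult_assoc_rule[OF \<mu>(4), of \<alpha>] mult_assoc_rule[OF \<mu>(4), of ?s]
      by (simp add: r_distr m_assoc)
  qed simp
  show ?thesis
    unfolding inj s
  proof
    assume "\<mu> \<otimes> \<alpha> \<oplus> \<epsilon> \<otimes> \<beta> \<otimes> t = e \<oplus> \<eta> \<otimes> \<mu>"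
    then have "(\<mu> \<otimes> \<alpha> \<oplus> \<epsilon> \<otimes> \<beta> \<otimes> t) \<ominus> \<epsilon> \<otimes> \<beta> \<otimes> t = (e \<oplus> \<eta> \<otimes> \<mu>) \<ominus> \<epsilon> \<otimes> \<beta> \<otimes> t" by simp
    then show "\<mu> \<otimes> \<alpha> = \<eta> \<otimes> \<mu> \<oplus> e \<ominus> \<epsilon> \<otimes> \<beta> \<otimes> t"
      by (simp add: minus_eq a_assoc r_neg a_comm[of "\<eta> \<otimes> \<mu>" e])
  next
    assume "\<mu> \<otimes> \<alpha> = \<eta> \<otimes> \<mu> \<oplus> e \<ominus> \<epsilon> \<otimes> \<beta> \<otimes> t"
    then show "\<mu> \<otimes> \<alpha> \<oplus> \<epsilon> \<otimes> \<beta> \<otimes> t = e \<oplus> \<eta> \<otimes> \<mu>"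
      by (simp add: minus_eq a_assoc l_neg a_comm[of "\<eta> \<otimes> \<mu>" e])
  qed
qed

end

section \<open>Equivalence of the three conditions\<close>

theorem lemma3p3:
  fixes R (structure) and e f a \<alpha> \<tau>
  assumes "ring R"
    and "is_idempotent R e"
    and "f = \<one> \<ominus> e"
    and "a \<in> left_mult R e"
    and "\<alpha> = e \<otimes> a \<otimes> e"
    and "\<tau> = f \<otimes> a \<otimes> e"
  shows
    "(clean R a \<longleftrightarrow>
      (\<exists>\<epsilon> \<mu> \<beta> \<gamma>.
        is_idempotent (corner R e) \<epsilon> \<and> \<mu> \<in> Units (corner R e) \<and>
        \<beta> \<in> peirce R e f \<and> \<gamma> \<in> peirce R f e \<and>
        \<epsilon> = \<epsilon> \<otimes> \<mu> \<otimes> \<alpha> \<oplus> \<epsilon> \<otimes> \<beta> \<otimes> (\<tau> \<oplus> \<gamma> \<otimes> \<alpha>) \<and>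
        e \<ominus> \<epsilon> = \<ominus> ((e \<ominus> \<epsilon>) \<otimes> \<mu> \<otimes> (e \<ominus> \<alpha>))))
     \<and>
     (clean R a \<longleftrightarrow>
      (\<exists>\<epsilon> \<mu> \<beta> \<gamma>.
        is_idempotent (corner R e) \<epsilon> \<and> \<mu> \<in> Units (corner R e) \<and>
        \<beta> \<in> peirce R e f \<and> \<gamma> \<in> peirce R f e \<and>
        \<alpha> = \<epsilon> \<oplus> \<mu> \<oplus> (e \<ominus> \<epsilon>) \<otimes> \<beta> \<otimes> (\<tau> \<oplus> \<gamma> \<otimes> \<alpha>)))"
proof -
  interpret ring R by fact
  have e: "e \<in> carrier R" "e \<otimes> e = e" using assms by (auto simp: is_idempotent_def)
  interpret peirce_decomposition R e f
    by unfold_locales (simp add: assms(3) complementary_minus e)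
  have a: "a \<in> carrier R" "a \<otimes> e = a"
    using assms(4) by (auto simp: left_mult_def m_assoc)
  have \<alpha>: "\<alpha> = e \<otimes> a" "\<alpha> \<in> peirce R e e" and \<tau>: "\<tau> = f \<otimes> a"
    using a assms(5,6) by (simp_all add: m_assoc peirce_iff ef_idem)
  have \<alpha>\<tau> [simp]: "\<alpha> \<in> carrier R" "\<tau> \<in> carrier R" using a \<alpha> \<tau> by simp_all
  have closed: "x \<in> carrier R" if "x \<in> peirce R e e \<or> x \<in> peirce R e f \<or> x \<in> peirce R f e" for x
    using that by (auto simp: peirce_mult)
  \<comment> \<open>Translates between the difference \<open>e \<ominus> \<epsilon>\<close> of the
    statement and a named complement \<open>\<eta>\<close>.\<close>
  have compl_iff: "is_idempotent (corner R e) \<epsilon> \<and> \<eta> = e \<ominus> \<epsilon> \<longleftrightarrow> complementary R e \<epsilon> \<eta>" for \<epsilon> \<eta>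
  proof
    assume "is_idempotent (corner R e) \<epsilon> \<and> \<eta> = e \<ominus> \<epsilon>"
    then show "complementary R e \<epsilon> \<eta>"
      by (auto intro!: complementary_minus simp: is_idempotent_corner_iff peirce_mult)
  next
    assume c: "complementary R e \<epsilon> \<eta>"
    then have [simp]: "\<epsilon> \<in> carrier R" "\<eta> \<in> carrier R" "\<epsilon> \<otimes> \<epsilon> = \<epsilon>" and sum: "\<epsilon> \<oplus> \<eta> = e"
      by (auto simp: complementary_def)
    have "\<eta> = e \<ominus> \<epsilon>"
      unfolding sum[symmetric] by (simp add: minus_eq a_comm[of \<epsilon>] a_assoc r_neg)
    then show "is_idempotent (corner R e) \<epsilon> \<and> \<eta> = e \<ominus> \<epsilon>"
      using complementary_absorb(1,2)[OF c]
      by (simp add: is_idempotent_corner_iff peirce_iff ef_idem)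
  qed
  \<comment> \<open>The single corner equation \<open>?E\<close> links all three conditions:
    \<open>clean_iff\<close> ties it to (1), \<open>E_iff\<close> to (2) with the same data, and
    \<open>EF\<close> to (3), which is \<open>?F\<close>, with changed data.\<close>
  let ?E = "\<lambda>\<epsilon> \<eta> \<mu> \<beta> \<gamma>. complementary R e \<epsilon> \<eta> \<and> \<mu> \<in> Units (corner R e) \<and> \<beta> \<in> peirce R e f \<and>
    \<gamma> \<in> peirce R f e \<and> \<mu> \<otimes> \<alpha> \<oplus> \<epsilon> \<otimes> \<beta> \<otimes> (\<tau> \<oplus> \<gamma> \<otimes> \<alpha>) = e \<oplus> \<eta> \<otimes> \<mu>"
  let ?F = "\<lambda>\<epsilon> \<eta> \<mu> \<beta> \<gamma>. complementary R e \<epsilon> \<eta> \<and> \<mu> \<in> Units (corner R e) \<and> \<beta> \<in> peirce R e f \<and>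
    \<gamma> \<in> peirce R f e \<and> \<alpha> = \<epsilon> \<oplus> \<mu> \<oplus> \<eta> \<otimes> \<beta> \<otimes> (\<tau> \<oplus> \<gamma> \<otimes> \<alpha>)"
  have clean_iff: "clean R a \<longleftrightarrow> (\<exists>\<epsilon> \<eta> \<mu> \<beta> \<gamma>. ?E \<epsilon> \<eta> \<mu> \<beta> \<gamma>)"
  proof
    assume "clean R a"
    then obtain \<epsilon> \<eta> w \<delta> where 1: "complementary R e \<epsilon> \<eta>" "w \<in> Units R" "\<delta> \<in> peirce R f e"
      "w \<otimes> a = (\<eta> \<oplus> f) \<otimes> w \<oplus> (\<one> \<ominus> \<delta>)"
      by (rule clean_imp_intertwiner[OF a])
    obtain \<mu> \<beta> \<gamma> where "\<mu> \<in> Units (corner R e)" "\<beta> \<in> peirce R e f" "\<gamma> \<in> peirce R f e"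
      "\<mu> \<otimes> (e \<otimes> a) \<oplus> \<epsilon> \<otimes> \<beta> \<otimes> (f \<otimes> a \<oplus> \<gamma> \<otimes> (e \<otimes> a)) = e \<oplus> \<eta> \<otimes> \<mu>"
      by (rule corner_equation_of_intertwiner[OF a 1])
    with 1(1) show "\<exists>\<epsilon> \<eta> \<mu> \<beta> \<gamma>. ?E \<epsilon> \<eta> \<mu> \<beta> \<gamma>"
      unfolding \<alpha>(1) \<tau> by (intro exI conjI)
  next
    assume "\<exists>\<epsilon> \<eta> \<mu> \<beta> \<gamma>. ?E \<epsilon> \<eta> \<mu> \<beta> \<gamma>"
    then show "clean R a"
      unfolding \<alpha>(1) \<tau> by (elim exE conjE) (rule clean_of_corner_equation[OF a])
  qed
  have E_iff: "?E \<epsilon> \<eta> \<mu> \<beta> \<gamma> \<longleftrightarrow> is_idempotent (corner R e) \<epsilon> \<and> \<eta> = e \<ominus> \<epsilon> \<and>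
        \<mu> \<in> Units (corner R e) \<and> \<beta> \<in> peirce R e f \<and> \<gamma> \<in> peirce R f e \<and>
        \<epsilon> = \<epsilon> \<otimes> \<mu> \<otimes> \<alpha> \<oplus> \<epsilon> \<otimes> \<beta> \<otimes> (\<tau> \<oplus> \<gamma> \<otimes> \<alpha>) \<and> \<eta> = \<ominus> (\<eta> \<otimes> \<mu> \<otimes> (e \<ominus> \<alpha>))"
    for \<epsilon> \<eta> \<mu> \<beta> \<gamma>
  proof -
    have "\<epsilon> = \<epsilon> \<otimes> \<mu> \<otimes> \<alpha> \<oplus> \<epsilon> \<otimes> \<beta> \<otimes> (\<tau> \<oplus> \<gamma> \<otimes> \<alpha>) \<and> \<eta> = \<ominus> (\<eta> \<otimes> \<mu> \<otimes> (e \<ominus> \<alpha>)) \<longleftrightarrow>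
        \<mu> \<otimes> \<alpha> \<oplus> \<epsilon> \<otimes> \<beta> \<otimes> (\<tau> \<oplus> \<gamma> \<otimes> \<alpha>) = e \<oplus> \<eta> \<otimes> \<mu>"
      if c: "complementary R e \<epsilon> \<eta>" "\<mu> \<in> Units (corner R e)" "\<beta> \<in> peirce R e f" "\<gamma> \<in> peirce R f e"
    proof -
      have [simp]: "\<epsilon> \<in> carrier R" "\<beta> \<in> carrier R" "\<gamma> \<in> carrier R" and \<mu>: "\<mu> \<in> peirce R e e"
        using c by (auto simp: complementary_def Units_corner_iff closed)
      have "\<epsilon> \<otimes> \<beta> \<otimes> (\<tau> \<oplus> \<gamma> \<otimes> \<alpha>) = \<epsilon> \<otimes> (\<beta> \<otimes> (\<tau> \<oplus> \<gamma> \<otimes> \<alpha>))" by (simp add: m_assoc)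
      then show ?thesis
        using corner_equations_iff[OF c(1) \<mu> \<alpha>(2), of "\<beta> \<otimes> (\<tau> \<oplus> \<gamma> \<otimes> \<alpha>)"]
        by (simp only: a_closed m_closed \<alpha>\<tau> \<open>\<beta> \<in> carrier R\<close> \<open>\<gamma> \<in> carrier R\<close> simp_thms)
    qed
    then show ?thesis using compl_iff[of \<epsilon> \<eta>] by blast
  qed
  \<comment> \<open>One change of data, keeping \<open>\<gamma>\<close> and hence the bracket,
    serves both directions: it carries \<open>?E\<close> to \<open>?F\<close> and \<open>?F\<close>
    to \<open>?E\<close>.\<close>
  have transfer: "\<exists>\<epsilon>' \<eta>' \<mu>' \<beta>'. complementary R e \<epsilon>' \<eta>' \<and> \<mu>' \<in> Units (corner R e) \<and> \<beta>' \<in> peirce R e f \<and>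
      (\<mu> \<otimes> \<alpha> \<oplus> \<epsilon> \<otimes> \<beta> \<otimes> (\<tau> \<oplus> \<gamma> \<otimes> \<alpha>) = e \<oplus> \<eta> \<otimes> \<mu> \<longleftrightarrow>
        \<alpha> = \<epsilon>' \<oplus> \<mu>' \<oplus> \<eta>' \<otimes> \<beta>' \<otimes> (\<tau> \<oplus> \<gamma> \<otimes> \<alpha>)) \<and>
      (\<alpha> = \<epsilon> \<oplus> \<mu> \<oplus> \<eta> \<otimes> \<beta> \<otimes> (\<tau> \<oplus> \<gamma> \<otimes> \<alpha>) \<longleftrightarrow>
        \<mu>' \<otimes> \<alpha> \<oplus> \<epsilon>' \<otimes> \<beta>' \<otimes> (\<tau> \<oplus> \<gamma> \<otimes> \<alpha>) = e \<oplus> \<eta>' \<otimes> \<mu>')"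
    if c: "complementary R e \<epsilon> \<eta>" "\<mu> \<in> Units (corner R e)" "\<beta> \<in> peirce R e f" "\<gamma> \<in> peirce R f e"
    for \<epsilon> \<eta> \<mu> \<beta> \<gamma>
  proof -
    obtain m where m: "\<mu> \<in> peirce R e e" "m \<in> peirce R e e" "\<mu> \<otimes> m = e" "m \<otimes> \<mu> = e"
      using c(2) by (auto simp: Units_corner_iff)
    have [simp]: "\<epsilon> \<in> carrier R" "\<eta> \<in> carrier R" "\<beta> \<in> carrier R" "\<gamma> \<in> carrier R"
        "\<mu> \<in> carrier R" "m \<in> carrier R" "e \<otimes> \<beta> = \<beta>" "\<beta> \<otimes> f = \<beta>" "e \<otimes> m = m"
      using c(1,3,4) m(1,2) by (auto simp: complementary_def peirce_mult)
    note [simp] = m(3,4) m(3,4)[THEN mult_assoc_rule] complementary_absorb(1-4)[OF c(1)]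
      complementary_absorb(1-4)[OF c(1), THEN mult_assoc_rule]
    \<comment> \<open>Conjugation by \<open>m\<close> comes with an exchange of roles: the new first
      idempotent is the conjugate of \<open>\<eta>\<close>, as the intertwining relations
      demand.\<close>
    have compl': "complementary R e (m \<otimes> \<eta> \<otimes> \<mu>) (m \<otimes> \<epsilon> \<otimes> \<mu>)"
      by (rule complementary_conj) (use c(1) m in \<open>auto simp: complementary_def a_comm\<close>)
    have "m \<in> Units (corner R e)" using m unfolding Units_corner_iff by blast
    moreover have "\<ominus> (m \<otimes> \<beta>) \<in> peirce R e f"
      using mult_assoc_rule[of e m m \<beta>]
      by (simp add: peirce_iff ef_idem m_assoc l_minus r_minus)
    moreover have "\<mu> \<otimes> \<alpha> \<oplus> \<epsilon> \<otimes> \<beta> \<otimes> (\<tau> \<oplus> \<gamma> \<otimes> \<alpha>) = e \<oplus> \<eta> \<otimes> \<mu> \<longleftrightarrow>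
        \<alpha> = m \<otimes> \<eta> \<otimes> \<mu> \<oplus> m \<oplus> m \<otimes> \<epsilon> \<otimes> \<mu> \<otimes> \<ominus> (m \<otimes> \<beta>) \<otimes> (\<tau> \<oplus> \<gamma> \<otimes> \<alpha>)"
      by (rule corner_equation_conj_iff[OF c(1) compl' m \<alpha>(2)])
        (simp_all add: m_assoc r_minus)
    \<comment> \<open>The same equivalence read backwards: the old data are obtained from the new
      ones by the same recipe, with \<open>\<mu>\<close> as inverse of \<open>m\<close>.\<close>
    moreover have "\<alpha> = \<epsilon> \<oplus> \<mu> \<oplus> \<eta> \<otimes> \<beta> \<otimes> (\<tau> \<oplus> \<gamma> \<otimes> \<alpha>) \<longleftrightarrow>
        m \<otimes> \<alpha> \<oplus> m \<otimes> \<eta> \<otimes> \<mu> \<otimes> \<ominus> (m \<otimes> \<beta>) \<otimes> (\<tau> \<oplus> \<gamma> \<otimes> \<alpha>) = e \<oplus> m \<otimes> \<epsilon> \<otimes> \<mu> \<otimes> m"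
      by (rule corner_equation_conj_iff[OF compl' c(1) m(2,1,4,3) \<alpha>(2), symmetric])
        (simp_all add: m_assoc)
    ultimately show ?thesis
      using compl' by (intro exI[of _ "m \<otimes> \<eta> \<otimes> \<mu>"] exI[of _ "m \<otimes> \<epsilon> \<otimes> \<mu>"] exI[of _ m]
          exI[of _ "\<ominus> (m \<otimes> \<beta>)"] conjI)
  qed
  have EF: "(\<exists>\<epsilon> \<eta> \<mu> \<beta> \<gamma>. ?E \<epsilon> \<eta> \<mu> \<beta> \<gamma>) \<longleftrightarrow> (\<exists>\<epsilon> \<eta> \<mu> \<beta> \<gamma>. ?F \<epsilon> \<eta> \<mu> \<beta> \<gamma>)"
  proof (intro iffI; elim exE conjE)
    fix \<epsilon> \<eta> \<mu> \<beta> \<gamma>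
    assume c: "complementary R e \<epsilon> \<eta>" "\<mu> \<in> Units (corner R e)" "\<beta> \<in> peirce R e f"
      "\<gamma> \<in> peirce R f e"
    note tr = transfer[OF c]
    show "\<exists>\<epsilon> \<eta> \<mu> \<beta> \<gamma>. ?F \<epsilon> \<eta> \<mu> \<beta> \<gamma>"
      if "\<mu> \<otimes> \<alpha> \<oplus> \<epsilon> \<otimes> \<beta> \<otimes> (\<tau> \<oplus> \<gamma> \<otimes> \<alpha>) = e \<oplus> \<eta> \<otimes> \<mu>"
      using tr that c(4) by (elim exE conjE) (intro exI conjI; blast)
    show "\<exists>\<epsilon> \<eta> \<mu> \<beta> \<gamma>. ?E \<epsilon> \<eta> \<mu> \<beta> \<gamma>"
      if "\<alpha> = \<epsilon> \<oplus> \<mu> \<oplus> \<eta> \<otimes> \<beta> \<otimes> (\<tau> \<oplus> \<gamma> \<otimes> \<alpha>)"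
      using tr that c(4) by (elim exE conjE) (intro exI conjI; blast)
  qed
  show ?thesis
  proof
    show "clean R a \<longleftrightarrow> (\<exists>\<epsilon> \<mu> \<beta> \<gamma>. is_idempotent (corner R e) \<epsilon> \<and> \<mu> \<in> Units (corner R e) \<and>
        \<beta> \<in> peirce R e f \<and> \<gamma> \<in> peirce R f e \<and>
        \<epsilon> = \<epsilon> \<otimes> \<mu> \<otimes> \<alpha> \<oplus> \<epsilon> \<otimes> \<beta> \<otimes> (\<tau> \<oplus> \<gamma> \<otimes> \<alpha>) \<and>
        e \<ominus> \<epsilon> = \<ominus> ((e \<ominus> \<epsilon>) \<otimes> \<mu> \<otimes> (e \<ominus> \<alpha>)))"
      unfolding clean_iff E_iff by blast
    show "clean R a \<longleftrightarrow> (\<exists>\<epsilon> \<mu> \<beta> \<gamma>. is_idempotent (corner R e) \<epsilon> \<and> \<mu> \<in> Units (corner R e) \<and>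
        \<beta> \<in> peirce R e f \<and> \<gamma> \<in> peirce R f e \<and>
        \<alpha> = \<epsilon> \<oplus> \<mu> \<oplus> (e \<ominus> \<epsilon>) \<otimes> \<beta> \<otimes> (\<tau> \<oplus> \<gamma> \<otimes> \<alpha>))"
      unfolding clean_iff EF by (simp only: flip: compl_iff) blast
  qed
qed

end
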